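(* Let $G$ be a finite connected graph with $n\ge 2$ vertices and diameter $d$, and let $G'$ be the $c$-cactus of $G$ for an integer $c>(d+1)n/(n-1)$. Then $G'$ is strongly non-stackable.
   Context: The $c$-cactus of $G$ is obtained from $G$ by attaching $c$ pendant edges (each to a new vertex of degree 1) to every vertex of $G$. Cup stacking on a finite connected graph: initially one cup on every vertex; a move takes all $r\ge1$ cups from a vertex $x$ onto a vertex $y\neq x$ that already carries at least one cup and satisfies $d(x,y)=r$ (shortest-path distance). A graph is $t$-stackable if some sequence of moves ends with all cups on $t$; it is strongly non-stackable if it is not $t$-stackable for any vertex $t$. *)

theory Defs
  imports "Graph_Theory.Graph_Theory"
begin

text \<open>
  Finite simple graphs are rendered by \<open>pair_graph\<close>: finite, loop-free, symmetric digraphs whose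
  arcs are ordered pairs, so each undirected edge is the two arcs \<open>(u, v)\<close> and \<open>(v, u)\<close>.
  The shortest-path distance is the library's minimal walk cost with unit arc weights;
  it is \<open>\<infinity>\<close> between vertices of different components.
\<close>

definition graph_dist :: "'a pair_pre_digraph \<Rightarrow> 'a \<Rightarrow> 'a \<Rightarrow> ereal" where
  "graph_dist G u v = wf_digraph.\<mu> (with_proj G) (\<lambda>_. 1) u v"

definition graph_diameter :: "'a pair_pre_digraph \<Rightarrow> ereal" where
  "graph_diameter G = (SUP u\<in>pverts G. SUP v\<in>pverts G. graph_dist G u v)"

text \<open>
  In the cactus, \<open>Inl v\<close> is the original vertex \<open>v\<close> and \<open>Inr (v, i)\<close>, for \<open>i < c\<close>, is the
  \<open>i\<close>-th new leaf attached to \<open>v\<close>.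
\<close>

definition cactus :: "nat \<Rightarrow> 'a pair_pre_digraph \<Rightarrow> ('a + 'a \<times> nat) pair_pre_digraph" where
  "cactus c G =
    \<lparr> pverts = Inl ` pverts G \<union> Inr ` (pverts G \<times> {..<c}),
      parcs = {(Inl u, Inl v) | u v. (u, v) \<in> parcs G}
            \<union> {(Inl v, Inr (v, i)) | v i. v \<in> pverts G \<and> i < c}
            \<union> {(Inr (v, i), Inl v) | v i. v \<in> pverts G \<and> i < c} \<rparr>"

text \<open>A configuration maps each vertex to the number of cups on it.\<close>

definition initial_cups :: "'a pair_pre_digraph \<Rightarrow> 'a \<Rightarrow> nat" where
  "initial_cups G v = (if v \<in> pverts G then 1 else 0)"

inductive cup_move :: "'a pair_pre_digraph \<Rightarrow> ('a \<Rightarrow> nat) \<Rightarrow> ('a \<Rightarrow> nat) \<Rightarrow> bool"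
  for G :: "'a pair_pre_digraph" where
  "\<lbrakk> x \<in> pverts G; y \<in> pverts G; x \<noteq> y; C x = r; r \<ge> 1; C y \<ge> 1;
     graph_dist G x y = ereal (real r) \<rbrakk>
   \<Longrightarrow> cup_move G C (C(x := 0, y := C y + r))"

definition stackable :: "'a pair_pre_digraph \<Rightarrow> 'a \<Rightarrow> bool" where
  "stackable G t \<longleftrightarrow>
    t \<in> pverts G \<and>
    (\<exists>C. (cup_move G)\<^sup>*\<^sup>* (initial_cups G) C \<and> (\<forall>v\<in>pverts G. v \<noteq> t \<longrightarrow> C v = 0))"

definition strongly_non_stackable :: "'a pair_pre_digraph \<Rightarrow> bool" where
  "strongly_non_stackable G \<longleftrightarrow> (\<forall>t\<in>pverts G. \<not> stackable G t)"

lemma pair_graph_cactus: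
  assumes "pair_graph G"
  shows "pair_graph (cactus c G)"
proof -
  interpret G: pair_graph G by fact
  have arcs: "parcs (cactus c G) \<subseteq> pverts (cactus c G) \<times> pverts (cactus c G)"
    by (auto simp: cactus_def dest: G.wellformed')
  have fin: "finite (pverts (cactus c G))"
    using G.pair_finite_verts by (simp add: cactus_def)
  have sym: "sym (parcs G)"
    using G.pair_sym_arcs by (simp add: symmetric_def)
  show ?thesis
  proof unfold_locales
    show "symmetric (with_proj (cactus c G))"
      using sym by (auto simp: symmetric_def cactus_def sym_def)
    show "finite (parcs (cactus c G))"
      using arcs fin by (meson finite_SigmaI finite_subset)
    show "fst e \<noteq> snd e" if "e \<in> parcs (cactus c G)" for e
      using that G.pair_no_loops by (force simp: cactus_def)
  qed (use arcs fin in auto)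
qed

end

theory Submission
  imports Defs
begin

text \<open>
  An emptied vertex never receives cups again, so the cup of an original vertex \<open>v\<close> moves along a
  chain of ever larger stacks. Charge every emptied leaf to an original vertex: a leaf that moves
  with a single cup moves onto its own base vertex and is charged to it, while a leaf that moves
  with at least two cups carries the cup of some original vertex and is charged to that one.
  Each charge to \<open>v\<close> accounts for a further cup in the stack containing the cup of \<open>v\<close>, and a
  stack can only move if it has at most \<open>d + 2\<close> cups (\<open>d + 1\<close> if it stands on an original vertex);
  hence at most \<open>d + 1\<close> leaves are charged to an original vertex other than the target.
  If all cups end at or next to \<open>v\<^sub>0\<close>, the \<open>(n - 1) c\<close> leaves not attached to \<open>v\<^sub>0\<close> are all charged,
  whence \<open>(n - 1) c \<le> n (d + 1)\<close>.
\<close>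

section \<open>Upper bounds on distances via walks\<close>

text \<open>A finite minimum cost is attained by a path, and unit weights make the cost of a walk
  its length. Distance bounds thus reduce to exhibiting walks.\<close>

lemma graph_dist_le_iff:
  assumes "pair_graph G"
  shows "graph_dist G u v \<le> ereal (real k) \<longleftrightarrow>
    (\<exists>p. pre_digraph.awalk (with_proj G) u p v \<and> length p \<le> k)"
proof -
  interpret G: pair_graph G by fact
  have cost: "G.awalk_cost (\<lambda>_. 1) p = real (length p)" for p
    by (induction p) auto
  show ?thesis
  proof
    assume le: "graph_dist G u v \<le> ereal (real k)"
    then have "G.\<mu> (\<lambda>_. 1) u v < \<infinity>"
      unfolding graph_dist_def by (rule le_less_trans) simp
    then have "reachable (with_proj G) u v"
      by (simp only: G.\<mu>_reach_conv)
    then obtain p where "G.apath u p v" "G.\<mu> (\<lambda>_. 1) u v = G.awalk_cost (\<lambda>_. 1) p"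
      using G.min_cost_awalk[of u v "\<lambda>_. 1"] by auto
    then show "\<exists>p. G.awalk u p v \<and> length p \<le> k"
      using le by (auto simp: graph_dist_def cost intro: G.awalkI_apath)
  next
    assume "\<exists>p. G.awalk u p v \<and> length p \<le> k"
    then obtain p where p: "G.awalk u p v" "length p \<le> k" by blast
    have "graph_dist G u v \<le> ereal (real (length p))"
      using G.min_cost_le_walk_cost[OF p(1), of "\<lambda>_. 1"] by (simp add: graph_dist_def cost)
    also have "\<dots> \<le> ereal (real k)" using p(2) by simp
    finally show "graph_dist G u v \<le> ereal (real k)" .
  qed
qed

lemma graph_dist_le_diameter:
  assumes "u \<in> pverts G" "v \<in> pverts G"
  shows "graph_dist G u v \<le> graph_diameter G"
  unfolding graph_diameter_def using assms by (meson SUP_upper2 SUP_upper)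

lemma graph_dist_triangle:
  assumes "pair_graph G"
    and "graph_dist G u v \<le> ereal (real k)" and "graph_dist G v w \<le> ereal (real l)"
  shows "graph_dist G u w \<le> ereal (real (k + l))"
proof -
  interpret G: pair_graph G by fact
  obtain p q where "G.awalk u p v" "length p \<le> k" "G.awalk v q w" "length q \<le> l"
    using assms by (auto simp: graph_dist_le_iff)
  then have "G.awalk u (p @ q) w \<and> length (p @ q) \<le> k + l"
    using G.awalk_appendI by auto
  then show ?thesis
    unfolding graph_dist_le_iff[OF assms(1)] by blast
qed

lemma graph_dist_arc_le:
  assumes "pair_graph G" "(u, v) \<in> parcs G"
  shows "graph_dist G u v \<le> ereal (real 1)"
proof -
  interpret G: pair_graph G by fact
  have "G.awalk u [(u, v)] v"
    using assms(2) G.arc_implies_awalk[of "(u, v)"] by simp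
  then show ?thesis
    unfolding graph_dist_le_iff[OF assms(1)] by (intro exI[of _ "[(u, v)]"]) simp
qed

section \<open>Distances in the cactus\<close>

lemma graph_dist_cactus_Inl_Inl_le:
  assumes "pair_graph G" "graph_dist G u v \<le> ereal (real k)"
  shows "graph_dist (cactus c G) (Inl u) (Inl v) \<le> ereal (real k)"
proof -
  interpret G: pair_graph G by fact
  interpret H: pair_graph "cactus c G" using assms(1) by (rule pair_graph_cactus)
  obtain p where p: "G.awalk u p v" "length p \<le> k"
    using assms by (auto simp: graph_dist_le_iff)
  have "H.awalk (Inl u) (map (map_prod Inl Inl) p) (Inl v)"
    using p(1)
  proof (induction p arbitrary: u)
    case Nil
    then have "u = v" "Inl v \<in> pverts (cactus c G)"
      by (auto simp: G.awalk_simps cactus_def)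
    then show ?case by (simp add: H.awalk_simps)
  next
    case (Cons e p)
    obtain w where e: "e = (u, w)" "(u, w) \<in> parcs G" "G.awalk w p v"
      using Cons.prems by (cases e) (auto simp: G.awalk_simps)
    then have "(Inl u, Inl w) \<in> parcs (cactus c G)" by (simp add: cactus_def)
    then show ?case using Cons.IH[OF e(3)] e(1) by (simp add: H.awalk_simps)
  qed
  then show ?thesis
    using p(2) unfolding graph_dist_le_iff[OF pair_graph_cactus[OF assms(1)]]
    by (intro exI[of _ "map (map_prod Inl Inl) p"]) simp
qed

text \<open>At most \<open>d\<close> steps between original vertices, plus one pendant edge if
  \<open>y\<close> is a leaf.\<close>

lemma graph_dist_cactus_Inl_le:
  assumes "pair_graph G" "graph_diameter G = ereal (real d)"
    and "u \<in> pverts G" "y \<in> pverts (cactus c G)"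
  shows "graph_dist (cactus c G) (Inl u) y \<le> ereal (real (d + 1))"
proof (cases y)
  case (Inl v)
  then have "v \<in> pverts G" using assms(4) by (auto simp: cactus_def)
  then have "graph_dist (cactus c G) (Inl u) y \<le> ereal (real d)"
    using assms Inl graph_dist_le_diameter[of u G v] by (auto intro: graph_dist_cactus_Inl_Inl_le)
  also have "\<dots> \<le> ereal (real (d + 1))" by simp
  finally show ?thesis .
next
  case (Inr z)
  then obtain v i where y: "y = Inr (v, i)" "v \<in> pverts G" "i < c"
    using assms(4) by (auto simp: cactus_def)
  have "graph_dist (cactus c G) (Inl u) (Inl v) \<le> ereal (real d)"
    using assms y graph_dist_le_diameter[of u G v] by (auto intro: graph_dist_cactus_Inl_Inl_le)
  moreover have "graph_dist (cactus c G) (Inl v) y \<le> ereal (real 1)"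
    by (rule graph_dist_arc_le[OF pair_graph_cactus[OF assms(1)]])
      (use y in \<open>auto simp: cactus_def\<close>)
  ultimately show ?thesis
    by (rule graph_dist_triangle[OF pair_graph_cactus[OF assms(1)]])
qed

lemma graph_dist_cactus_le:
  assumes "pair_graph G" "graph_diameter G = ereal (real d)"
    and "x \<in> pverts (cactus c G)" "y \<in> pverts (cactus c G)"
  shows "graph_dist (cactus c G) x y \<le> ereal (real (d + 2))"
proof (cases x)
  case (Inl u)
  then have "graph_dist (cactus c G) x y \<le> ereal (real (d + 1))"
    using assms graph_dist_cactus_Inl_le[of G d u y c] by (auto simp: cactus_def)
  also have "\<dots> \<le> ereal (real (d + 2))" by simp
  finally show ?thesis .
next
  case (Inr z)
  then obtain v i where x: "x = Inr (v, i)" "v \<in> pverts G" "i < c"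
    using assms(3) by (auto simp: cactus_def)
  have "graph_dist (cactus c G) x (Inl v) \<le> ereal (real 1)"
    by (rule graph_dist_arc_le[OF pair_graph_cactus[OF assms(1)]])
      (use x in \<open>auto simp: cactus_def\<close>)
  from graph_dist_triangle[OF pair_graph_cactus[OF assms(1)] this
      graph_dist_cactus_Inl_le[OF assms(1,2) x(2) assms(4)]]
  show ?thesis by simp
qed

text \<open>Forces a leaf holding a single cup to move onto its base: a walk of length at most 1 to
  another vertex is one arc, and the arcs out of a leaf lead only to its base.\<close>

lemma cactus_leaf_neighbour:
  assumes "pair_graph G" "graph_dist (cactus c G) (Inr (v, i)) y \<le> ereal (real 1)"
    and "y \<noteq> Inr (v, i)"
  shows "y = Inl v"
proof -
  interpret H: pair_graph "cactus c G" using assms(1) by (rule pair_graph_cactus)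
  obtain p where p: "H.awalk (Inr (v, i)) p y" "length p \<le> 1"
    using assms(2) unfolding graph_dist_le_iff[OF pair_graph_cactus[OF assms(1)]] by blast
  with assms(3) obtain e where "p = [e]"
    by (cases p) (auto simp: H.awalk_simps)
  with p(1) have "(Inr (v, i), y) \<in> parcs (cactus c G)"
    by (cases e) (auto simp: H.awalk_simps)
  then show ?thesis
    by (simp add: cactus_def)
qed

section \<open>The charging invariant and its preservation\<close>

text \<open>
  Here \<open>pos v\<close> is the vertex whose stack contains the original cup of \<open>v\<close>, and \<open>A v\<close> is the set of
  leaves charged to \<open>v\<close>. The \<open>2\<close> in the first clause also counts the leaf's own cup.
\<close>

definition charged ::
  "nat \<Rightarrow> nat \<Rightarrow> 'a pair_pre_digraph \<Rightarrow> ('a + 'a \<times> nat \<Rightarrow> nat) \<Rightarrow>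
    ('a \<Rightarrow> 'a + 'a \<times> nat) \<Rightarrow> ('a \<Rightarrow> ('a \<times> nat) set) \<Rightarrow> bool" where
  "charged d c G C pos A \<longleftrightarrow>
    (\<forall>v\<in>pverts G. card (A v) + (if isl (pos v) then 1 else 2) \<le> C (pos v)) \<and>
    (\<forall>v\<in>pverts G. finite (A v) \<and> pos v \<in> pverts (cactus c G)) \<and>
    (\<forall>v\<in>pverts G. C (Inl v) \<ge> 1 \<longrightarrow> pos v = Inl v) \<and>
    (\<forall>l. C (Inr l) \<ge> 2 \<longrightarrow> (\<exists>v\<in>pverts G. pos v = Inr l)) \<and>
    (\<forall>l\<in>pverts G \<times> {..<c}. C (Inr l) = 0 \<longrightarrow> (\<exists>v\<in>pverts G. l \<in> A v)) \<and>
    (\<forall>v\<in>pverts G. pos v \<noteq> Inl v \<longrightarrow> card (A v) \<le> d + 1) \<and>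
    (\<forall>v\<in>pverts G. pos v = Inl v \<longrightarrow> A v \<subseteq> {v} \<times> UNIV)"

lemma charged_initial: "charged d c G (initial_cups (cactus c G)) Inl (\<lambda>_. {})"
  by (auto simp: charged_def initial_cups_def cactus_def)

text \<open>The positions follow the moved stack, while \<open>A\<close> changes only when the move
  empties a leaf.\<close>

lemma charged_cup_move:
  assumes G: "pair_graph G" "graph_diameter G = ereal (real d)"
    and inv: "charged d c G C pos A"
    and "cup_move (cactus c G) C C'"
  shows "\<exists>pos' A'. charged d c G C' pos' A'"
  using assms(4)
proof cases
  case (1 x y r)
  note C' = \<open>C' = _\<close> and dist = \<open>graph_dist _ x y = _\<close>
  have r: "r \<le> d + 2"
    using graph_dist_cactus_le[OF G 1(2,3)] dist by simp
  define pos' where "pos' v = (if pos v = x then y else pos v)" for v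
  have size: "card (A v) + (if isl (pos v) then 1 else 2) \<le> C (pos v)"
    and fin: "finite (A v)" "pos v \<in> pverts (cactus c G)"
    and home: "C (Inl v) \<ge> 1 \<Longrightarrow> pos v = Inl v"
    and away: "pos v \<noteq> Inl v \<Longrightarrow> card (A v) \<le> d + 1"
    and own: "pos v = Inl v \<Longrightarrow> A v \<subseteq> {v} \<times> UNIV" if "v \<in> pverts G" for v
    using inv that by (auto simp: charged_def)
  have carry: "\<exists>v\<in>pverts G. pos v = Inr l" if "C (Inr l) \<ge> 2" for l
    using inv that unfolding charged_def by blast
  have empty: "\<exists>v\<in>pverts G. l \<in> A v" if "l \<in> pverts G \<times> {..<c}" "C (Inr l) = 0" for l
    using inv that by (auto simp: charged_def)
  \<comment> \<open>No cup comes back home: if \<open>y = Inl v\<close>, then \<open>y\<close> is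
    nonempty, so by \<open>home\<close> the cup of \<open>v\<close> already lies there and not on
    \<open>x\<close>.\<close>
  have returns: "pos v = Inl v" "x \<noteq> Inl v" if "pos' v = Inl v" "v \<in> pverts G" for v
    using that home[of v] 1 by (auto simp: pos'_def split: if_splits)
  \<comment> \<open>If the leaf is \<open>y\<close>, the arriving stack must contain an original
    cup: a leaf with one cup could only move onto its base, which is no leaf.\<close>
  have carry': "\<exists>v\<in>pverts G. pos' v = Inr l" if "C' (Inr l) \<ge> 2" for l
  proof (cases "Inr l = y")
    case True
    have "\<exists>v\<in>pverts G. pos v = x"
    proof (cases x)
      case (Inl u)
      then show ?thesis using 1 home[of u] by (auto simp: cactus_def)
    next
      case (Inr m)
      have "r \<noteq> 1"
      proof
        assume "r = 1"
        then have "y = Inl (fst m)"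
          using cactus_leaf_neighbour[OF G(1), of c "fst m" "snd m" y] 1 Inr by auto
        with True show False by simp
      qed
      with 1 Inr show ?thesis using carry[of m] by auto
    qed
    then show ?thesis using True by (auto simp: pos'_def)
  next
    case False
    then have "Inr l \<noteq> x" "C (Inr l) \<ge> 2" using that C' by (auto split: if_splits)
    then obtain v where "v \<in> pverts G" "pos v = Inr l" "Inr l \<noteq> x" using carry by blast
    then show ?thesis by (metis pos'_def)
  qed
  have home': "pos' v = Inl v" if "v \<in> pverts G" "C' (Inl v) \<ge> 1" for v
    using that home[of v] 1 by (auto simp: pos'_def split: if_splits)
  have fin': "pos' v \<in> pverts (cactus c G)" if "v \<in> pverts G" for v
    using that fin 1 by (auto simp: pos'_def)
  \<comment> \<open>The cup already on \<open>y\<close> pays for a possible rise of the summand from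
    1 to 2.\<close>
  have size_stay: "card (A v) + (if isl (pos' v) then 1 else 2) \<le> C' (pos' v)"
    if "v \<in> pverts G" for v
    using size[OF that] 1 by (auto simp: pos'_def split: if_splits)
  show ?thesis
  proof (cases x)
    case (Inl u)
    have "r \<le> d + 1"
      using graph_dist_cactus_Inl_le[OF G _ 1(3), of u] dist 1(2) Inl by (auto simp: cactus_def)
    \<comment> \<open>A cup that leaves with the stack on \<open>Inl u\<close> has
      \<open>card (A v) + 1 \<le> r \<le> d + 1\<close>.\<close>
    then have away': "card (A v) \<le> d + 1" if "v \<in> pverts G" "pos' v \<noteq> Inl v" for v
      using that away[of v] size[of v] 1 Inl
      by (cases "pos v = x") (auto simp: pos'_def)
    have empty': "\<exists>v\<in>pverts G. l \<in> A v" if "l \<in> pverts G \<times> {..<c}" "C' (Inr l) = 0" for l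
      using that empty[of l] 1 Inl by (auto split: if_splits)
    have "charged d c G C' pos' A"
      unfolding charged_def
      using size_stay fin(1) fin' home' carry' empty' away' own returns(1) by blast
    then show ?thesis by blast
  next
    case (Inr l)
    obtain u i where l: "l = (u, i)" "u \<in> pverts G"
      using Inr 1 by (auto simp: cactus_def)
    \<comment> \<open>The vertex to be charged for \<open>l\<close>: its base if
      \<open>r = 1\<close>, which is still at home because \<open>y\<close> is nonempty; otherwise
      one whose cup lies on \<open>x\<close>, given by \<open>carry\<close>.\<close>
    have "\<exists>v\<in>pverts G. if r = 1 then v = u \<and> y = Inl u \<and> pos v = Inl u else pos v = x"
    proof (cases "r = 1")
      case True
      then have "y = Inl u"
        using cactus_leaf_neighbour[OF G(1), of c u i y] 1 Inr l by auto
      then show ?thesis using True l home[of u] 1 by auto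
    next
      case False
      then show ?thesis using carry[of l] 1 Inr by auto
    qed
    then obtain v where v: "v \<in> pverts G"
      and single: "r = 1 \<Longrightarrow> v = u \<and> y = Inl u \<and> pos v = Inl u"
      and several: "r \<noteq> 1 \<Longrightarrow> pos v = x" by metis
    define A' where "A' = A(v := insert l (A v))"
    have card_A': "card (A' v) \<le> card (A v) + 1"
      using fin(1)[OF v] by (simp add: A'_def card_insert_if)
    have finA': "finite (A' w)" if "w \<in> pverts G" for w
      using fin(1)[OF that] fin(1)[OF v] by (simp add: A'_def)
    \<comment> \<open>For \<open>r = 1\<close> the new charge is paid by the cup added to
      \<open>y\<close>. Otherwise the stack on the leaf gives \<open>card (A v) + 2 \<le> r\<close>,
      and the cup on \<open>y\<close> makes room for one more charge even if \<open>y\<close> is a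
      leaf.\<close>
    have size': "card (A' w) + (if isl (pos' w) then 1 else 2) \<le> C' (pos' w)"
      if "w \<in> pverts G" for w
    proof (cases "w = v")
      case True
      then show ?thesis
        using size[OF v] card_A' single several 1 Inr
        by (cases "r = 1") (auto simp: pos'_def split: if_splits)
    next
      case False
      then show ?thesis using size_stay[OF that] by (simp add: A'_def)
    qed
    \<comment> \<open>Before the move \<open>card (A v) + 2 \<le> r \<le> d + 2\<close> if
      \<open>r \<noteq> 1\<close>, so one further charge still fits; if \<open>r = 1\<close>, then
      \<open>v\<close> stays at home.\<close>
    have away': "card (A' w) \<le> d + 1" if "w \<in> pverts G" "pos' w \<noteq> Inl w" for w
    proof (cases "w = v")
      case True
      then have "r \<noteq> 1" using that(2) single 1 by (auto simp: pos'_def)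
      then show ?thesis
        using True several size[OF v] card_A' r 1 Inr by auto
    next
      case False
      then show ?thesis
        using that away[of w] size[of w] r 1 Inr
        by (cases "pos w = x") (auto simp: pos'_def A'_def)
    qed
    \<comment> \<open>A vertex at home after the move was not on \<open>x\<close>, so it gains a
      charge only if \<open>r = 1\<close>, and then from its own leaf.\<close>
    have own': "A' w \<subseteq> {w} \<times> UNIV" if "w \<in> pverts G" "pos' w = Inl w" for w
      using own[of w] returns[OF that(2,1)] that several single l Inr
      by (cases "r = 1") (auto simp: A'_def)
    have empty': "\<exists>v\<in>pverts G. m \<in> A' v" if "m \<in> pverts G \<times> {..<c}" "C' (Inr m) = 0" for m
    proof (cases "m = l")
      case True
      then show ?thesis using v by (auto simp: A'_def)
    next
      case False
      then have "C (Inr m) = 0" using that 1 Inr by (auto split: if_splits)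
      then show ?thesis using empty[OF that(1)] by (auto simp: A'_def)
    qed
    have "charged d c G C' pos' A'"
      unfolding charged_def
      using size' finA' fin' home' carry' empty' away' own' by blast
    then show ?thesis by blast
  qed
qed

lemma charged_reachable:
  assumes "pair_graph G" "graph_diameter G = ereal (real d)"
    and "(cup_move (cactus c G))\<^sup>*\<^sup>* (initial_cups (cactus c G)) C"
  shows "\<exists>pos A. charged d c G C pos A"
  using assms(3)
proof (induction rule: rtranclp_induct)
  case base
  show ?case using charged_initial by blast
next
  case (step C C')
  then show ?case using charged_cup_move[OF assms(1,2)] by blast
qed

section \<open>Counting the charged leaves\<close>

lemma stackable_cactus_le:
  assumes "pair_graph G" "graph_diameter G = ereal (real d)" "stackable (cactus c G) t"
  shows "(card (pverts G) - 1) * c \<le> card (pverts G) * (d + 1)"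
proof -
  interpret G: pair_graph G by fact
  obtain C where C: "(cup_move (cactus c G))\<^sup>*\<^sup>* (initial_cups (cactus c G)) C"
    "\<forall>v\<in>pverts (cactus c G). v \<noteq> t \<longrightarrow> C v = 0" and t: "t \<in> pverts (cactus c G)"
    using assms(3) by (auto simp: stackable_def)
  obtain pos A where inv: "charged d c G C pos A"
    using charged_reachable[OF assms(1,2) C(1)] by blast
  obtain v0 where v0: "v0 \<in> pverts G" "t = Inl v0 \<or> (\<exists>i. t = Inr (v0, i))"
    using t by (auto simp: cactus_def)
  \<comment> \<open>The cup of \<open>v0\<close> may never move, and then only the leaves of
    \<open>v0\<close> itself are charged to it, with no bound by \<open>d + 1\<close>. Discarding
    these leaves makes the bound uniform.\<close>
  define B where "B v = A v - {v0} \<times> UNIV" for v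
  \<comment> \<open>The size clause makes \<open>C (pos v)\<close> positive, and only
    \<open>t\<close> still carries cups.\<close>
  have pos: "pos v = t" if "v \<in> pverts G" for v
  proof (rule ccontr)
    assume "pos v \<noteq> t"
    then have "C (pos v) = 0" using C(2) inv that by (auto simp: charged_def)
    moreover have "card (A v) + (if isl (pos v) then 1 else 2) \<le> C (pos v)"
      using inv that by (auto simp: charged_def)
    ultimately show False by (auto split: if_splits)
  qed
  have fin: "finite (A v)" if "v \<in> pverts G" for v
    using inv that by (auto simp: charged_def)
  have B: "card (B v) \<le> d + 1" if v: "v \<in> pverts G" for v
  proof (cases "pos v = Inl v")
    case True
    then have "v = v0" using pos[OF v] v0(2) by auto
    moreover have "A v \<subseteq> {v} \<times> UNIV" using inv v True by (auto simp: charged_def)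
    ultimately have "B v = {}" by (auto simp: B_def)
    then show ?thesis by simp
  next
    case False
    have "card (B v) \<le> card (A v)"
      by (rule card_mono) (auto simp: B_def fin v)
    also have "\<dots> \<le> d + 1" using inv v False by (auto simp: charged_def)
    finally show ?thesis .
  qed
  have "(pverts G - {v0}) \<times> {..<c} \<subseteq> (\<Union>v\<in>pverts G. B v)"
  proof
    fix l assume l: "l \<in> (pverts G - {v0}) \<times> {..<c}"
    then have "Inr l \<noteq> t" "Inr l \<in> pverts (cactus c G)"
      using v0 by (auto simp: cactus_def)
    then have "C (Inr l) = 0" using C(2) by blast
    moreover have "l \<in> pverts G \<times> {..<c}" using l by auto
    ultimately have "\<exists>v\<in>pverts G. l \<in> A v" using inv by (auto simp: charged_def)
    then show "l \<in> (\<Union>v\<in>pverts G. B v)" using l by (auto simp: B_def)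
  qed
  then have "card ((pverts G - {v0}) \<times> {..<c}) \<le> card (\<Union>v\<in>pverts G. B v)"
    by (rule card_mono[rotated]) (auto simp: B_def fin)
  also have "\<dots> \<le> (\<Sum>v\<in>pverts G. card (B v))"
    by (rule card_UN_le) simp
  also have "\<dots> \<le> card (pverts G) * (d + 1)"
    using sum_bounded_above[of "pverts G" "\<lambda>v. card (B v)" "d + 1"] B by simp
  finally show ?thesis
    using v0(1) by (simp add: card_cartesian_product)
qed

theorem theorem4p2:
  fixes G :: "'a pair_pre_digraph" and n d c :: nat
  assumes "pair_graph G"
    and "connected (with_proj G)"
    and "card (pverts G) = n"
    and "n \<ge> 2"
    and "graph_diameter G = ereal (real d)"
    and "real c > (real d + 1) * real n / (real n - 1)"
  shows "strongly_non_stackable (cactus c G)"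
  unfolding strongly_non_stackable_def
proof (intro ballI notI)
  fix t assume "stackable (cactus c G) t"
  then have "(n - 1) * c \<le> n * (d + 1)"
    using stackable_cactus_le assms(1,3,5) by blast
  then have "real ((n - 1) * c) \<le> real (n * (d + 1))"
    by (simp only: of_nat_le_iff)
  \<comment> \<open>As \<open>n \<ge> 2\<close>, the truncated difference \<open>n - 1\<close> is
    exact and positive, so the hypothesis on \<open>c\<close> can be cleared of its
    denominator.\<close>
  then have "(real n - 1) * real c \<le> real n * (real d + 1)"
    using assms(4) by (simp add: of_nat_diff algebra_simps)
  moreover have "(real d + 1) * real n < real c * (real n - 1)"
    using assms(4,6) by (simp add: divide_less_eq)
  ultimately show False by (simp add: mult.commute)
qed

end
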